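(* There exist absolute positive constants $c_0,\ldots,c_5$ for which the following holds. For any integer $n\ge c_0$, there are a pair of random variables $(X,Y)$ and a dictionary $F=\{f_1,f_2\}$ of two functions such that $(Y-f_i(X))^2\le 1$ almost surely for $i=1,2$, and for which the quadratic risk of the aggregate with exponential weights $\tilde f^{\mathrm{AEW}}$ with temperature $T>0$, constructed from $n$ i.i.d. copies of $(X,Y)$, satisfies the following: 1. if $T\le c_1$ and $n$ is odd, then $$\mathbb{E}\,R(\tilde f^{\mathrm{AEW}})\ \ge\ \min_{f\in F}R(f)+\frac{c_2}{\sqrt n};$$ 2. if $T\le c_3\sqrt n/\log n$, then, with probability greater than $c_4$, $$R(\tilde f^{\mathrm{AEW}})\ \ge\ \min_{f\in F}R(f)+\frac{c_5}{\sqrt n}.$$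
   Context: Let $Z=(X,Y)$, where $X$ takes values in a measurable space $\mathcal X$ and $Y$ is real-valued, and let $Z_i=(X_i,Y_i)$, $1\le i\le n$, be i.i.d. copies of $Z$ (the data $\mathcal D$). The quadratic loss is $Q((X,Y),f)=(Y-f(X))^2$ for measurable $f:\mathcal X\to\mathbb R$; the quadratic risk is $R(f)=\mathbb E\,Q(Z,f)$ and the empirical risk is $R_n(f)=\frac1n\sum_{i=1}^n Q(Z_i,f)$. If $\hat f$ is a function depending on the data, then $R(\hat f)=\mathbb E[Q(Z,\hat f)\mid \mathcal D]$, with $Z$ independent of $\mathcal D$; it is a random variable. A dictionary is a finite set of measurable real-valued functions on $\mathcal X$. For a dictionary $F=\{f_1,\ldots,f_M\}$ and a temperature $T>0$, the aggregate with exponential weights (AEW) is $$\tilde f^{\mathrm{AEW}}=\sum_{j=1}^M\hat\theta_j f_j,\qquad \hat\theta_j=\frac{\exp(-\frac nT R_n(f_j))}{\sum_{k=1}^M\exp(-\frac nT R_n(f_k))}.$$ *)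

theory Defs
  imports "HOL-Probability.Probability"
begin

definition quad_loss :: "'x \<times> real \<Rightarrow> ('x \<Rightarrow> real) \<Rightarrow> real" where
  "quad_loss z f = (snd z - f (fst z))\<^sup>2"

definition quad_risk :: "'w measure \<Rightarrow> ('w \<Rightarrow> 'x \<times> real) \<Rightarrow> ('x \<Rightarrow> real) \<Rightarrow> real" where
  "quad_risk M Z f = (\<integral>\<omega>. quad_loss (Z \<omega>) f \<partial>M)"

definition emp_risk :: "nat \<Rightarrow> (nat \<Rightarrow> 'x \<times> real) \<Rightarrow> ('x \<Rightarrow> real) \<Rightarrow> real" where
  "emp_risk n d f = (\<Sum>i=1..n. quad_loss (d i) f) / real n"

definition aew_weight ::
    "nat \<Rightarrow> real \<Rightarrow> (nat \<Rightarrow> 'x \<times> real) \<Rightarrow> ('x \<Rightarrow> real) set \<Rightarrow> ('x \<Rightarrow> real) \<Rightarrow> real" where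
  "aew_weight n T d F f =
     exp (- (real n / T) * emp_risk n d f) / (\<Sum>g\<in>F. exp (- (real n / T) * emp_risk n d g))"

definition aew ::
    "nat \<Rightarrow> real \<Rightarrow> (nat \<Rightarrow> 'x \<times> real) \<Rightarrow> ('x \<Rightarrow> real) set \<Rightarrow> 'x \<Rightarrow> real" where
  "aew n T d F x = (\<Sum>f\<in>F. aew_weight n T d F f * f x)"

text \<open>
  \<open>Zs 1, \<dots>, Zs n\<close> are i.i.d. copies of \<open>Z\<close>, and \<open>Z\<close> itself is independent of them. The update
  puts \<open>Z\<close> at index 0 of the family (the value \<open>Zs 0\<close> is irrelevant); measurability of all the
  variables involved is part of \<open>indep_vars\<close>.
\<close>

definition iid_copies ::
    "'w measure \<Rightarrow> 'z measure \<Rightarrow> nat \<Rightarrow> ('w \<Rightarrow> 'z) \<Rightarrow> (nat \<Rightarrow> 'w \<Rightarrow> 'z) \<Rightarrow> bool" where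
  "iid_copies M S n Z Zs \<longleftrightarrow>
     prob_space.indep_vars M (\<lambda>_. S) (Zs(0 := Z)) {0..n} \<and>
     (\<forall>i\<in>{1..n}. distr M S (Zs i) = distr M S Z)"

definition data_algebra ::
    "'w measure \<Rightarrow> 'z measure \<Rightarrow> nat \<Rightarrow> (nat \<Rightarrow> 'w \<Rightarrow> 'z) \<Rightarrow> 'w measure" where
  "data_algebra M S n Zs =
     vimage_algebra (space M) (\<lambda>\<omega>. \<lambda>i\<in>{1..n}. Zs i \<omega>) (PiM {1..n} (\<lambda>_. S))"

text \<open>
  The risk of a data-dependent function \<open>fhat\<close>, where \<open>fhat \<omega>\<close> is the function selected at
  outcome \<open>\<omega>\<close>: the conditional expectation of its loss at \<open>Z\<close> given the data. It is a random
  variable, determined up to a null set.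
\<close>

definition cond_risk ::
    "'w measure \<Rightarrow> 'w measure \<Rightarrow> ('w \<Rightarrow> 'x \<times> real) \<Rightarrow> ('w \<Rightarrow> 'x \<Rightarrow> real) \<Rightarrow> 'w \<Rightarrow> real" where
  "cond_risk M D Z fhat = real_cond_exp M D (\<lambda>\<omega>. quad_loss (Z \<omega>) (fhat \<omega>))"

definition aew_risk ::
    "'w measure \<Rightarrow> 'x measure \<Rightarrow> nat \<Rightarrow> real \<Rightarrow> ('w \<Rightarrow> 'x \<times> real) \<Rightarrow> (nat \<Rightarrow> 'w \<Rightarrow> 'x \<times> real) \<Rightarrow>
      ('x \<Rightarrow> real) set \<Rightarrow> 'w \<Rightarrow> real" where
  "aew_risk M N n T Z Zs F =
     cond_risk M (data_algebra M (N \<Otimes>\<^sub>M borel) n Zs) Z (\<lambda>\<omega>. aew n T (\<lambda>i. Zs i \<omega>) F)"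

end

theory Submission
  imports Defs
begin

text \<open>
  Let \<open>Y = 0\<close> and let the dictionary consist of the indicators of \<open>{1}\<close> and of its complement, so that
  exactly one of the two functions errs at each observation, with loss \<open>1\<close>. Take \<open>X \<in> {0, 1}\<close> with
  \<open>P(X = 1) = p = (1 - \<Delta>) / 2\<close> and \<open>\<Delta> = 1 / (4 sqrt n)\<close>. The first function is better, by a gap \<open>\<Delta>\<close> in
  risk. If \<open>k\<close> observations have \<open>X = 1\<close> and \<open>s = 2k - n\<close>, it receives the weight
  \<open>\<theta> = 1 / (1 + exp (s / T))\<close>, and the aggregate has the excess risk \<open>(1 - \<theta>) (\<Delta> - \<theta>)\<close>
  (\<open>aew_indicators\<close>, \<open>aew_risk_indicators\<close>).
  
  The gap is hidden by the noise: \<open>s\<close> is a sum of \<open>n\<close> signs of mean \<open>- \<Delta>\<close>, its mean is \<open>- sqrt n / 4\<close> and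
  its standard deviation is about \<open>sqrt n\<close>. So with a probability bounded below \<open>s\<close> exceeds
  \<open>sqrt n / 4\<close> (\<open>wrong_majority_probability\<close>). If \<open>T \<le> sqrt n / (4 ln n)\<close>, then \<open>\<theta> \<le> 1 / n\<close> on this
  event: the aggregate nearly selects the worse function and its excess risk is of the order of
  \<open>\<Delta>\<close> (\<open>excess_ge_of_wrong_majority\<close>). This is the statement in probability.
  
  In expectation the negative values of the excess matter, which come from \<open>\<theta> > \<Delta>\<close>. They are bounded by
  \<open>\<theta> (1 - \<theta>) \<le> exp (- \<bar>s\<bar> / T)\<close>, and each value of \<open>s\<close> has probability of order at most \<open>1 / sqrt n\<close>
  near zero. For odd \<open>n\<close> the value \<open>s = 0\<close> does not occur, so the expected benefit of mixing is at
  most a constant times \<open>exp (- c / T) / sqrt n\<close>. A small absolute bound on \<open>T\<close> makes this smaller than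
  the expected loss due to wrong majorities (\<open>expected_excess_ge\<close>).
  
  The estimates for the biased signs come from those for fair signs by comparing the two
  distributions pointwise (\<open>Bernstein_ge_half\<close>, \<open>Bernstein_le_half\<close>). For fair signs they follow
  from the bound \<open>2^n / sqrt n\<close> for the binomial coefficients and from the variance.
\<close>

section \<open>Fair and slightly biased binomial distributions\<close>

text \<open>
  The factor \<open>2 * m + 1\<close> is the one that makes the induction close: passing from \<open>m\<close> to \<open>m + 1\<close>
  multiplies the left-hand side by \<open>4 (2m+1) (2m+3) / (m+1)\<^sup>2\<close>, and \<open>(2m+1) (2m+3) \<le> 4 (m+1)\<^sup>2\<close>.
\<close>

lemma central_binomial_square_bound: "(2 * m choose m)\<^sup>2 * (2 * m + 1) \<le> (16::nat) ^ m"
proof (induction m)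
  case 0
  show ?case by simp
next
  case (Suc m)
  let ?c = "2 * m choose m" and ?d = "2 * Suc m choose Suc m"
  have d: "Suc m * ?d = 2 * Suc m * (Suc (2 * m) choose m)"
    using Suc_times_binomial[of m "Suc (2 * m)"] by (simp only: mult_Suc_right add_2_eq_Suc)
  have "Suc (2 * m) choose m = Suc (2 * m) choose Suc m"
    using binomial_symmetric[of m "Suc (2 * m)"] by (simp only: Suc_diff_le) (simp add: mult_2)
  then have "Suc m * (Suc (2 * m) choose m) = (2 * m + 1) * ?c"
    using Suc_times_binomial[of m "2 * m"] by (simp only: Suc_eq_plus1)
  then have step: "Suc m * ?d = 2 * (2 * m + 1) * ?c"
    by (simp only: d mult.assoc)
  have "(Suc m)\<^sup>2 * (?d\<^sup>2 * (2 * Suc m + 1)) = (Suc m * ?d)\<^sup>2 * (2 * m + 3)"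
  proof -
    have "2 * Suc m + 1 = 2 * m + 3" by simp
    then show ?thesis by (simp only: power_mult_distrib mult.assoc)
  qed
  also have "\<dots> = 4 * (2 * m + 1) * (2 * m + 3) * (?c\<^sup>2 * (2 * m + 1))"
    unfolding step by (simp only: power2_eq_square) (simp add: algebra_simps)
  also have "\<dots> \<le> 16 * (Suc m)\<^sup>2 * 16 ^ m"
    by (rule mult_mono[OF _ Suc]) (auto simp: power2_eq_square algebra_simps)
  also have "\<dots> = (Suc m)\<^sup>2 * 16 ^ Suc m" by (simp add: algebra_simps)
  finally show ?case by (simp only: mult_le_cancel1) auto
qed

lemma central_binomial_upper_bound: "real (2 * m choose m) * sqrt (2 * m + 1) \<le> 4 ^ m"
proof (rule power2_le_imp_le)
  have "real ((2 * m choose m)\<^sup>2 * (2 * m + 1)) \<le> real (16 ^ m)"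
    using central_binomial_square_bound[of m] by (simp only: of_nat_le_iff)
  moreover have "(4::real) ^ m * 4 ^ m = 16 ^ m" by (simp flip: power_mult_distrib)
  ultimately show "(real (2 * m choose m) * sqrt (2 * m + 1))\<^sup>2 \<le> (4 ^ m)\<^sup>2"
    by (simp add: power_mult_distrib) (simp add: power2_eq_square algebra_simps)
qed simp

text \<open>
  No value of a fair binomial variable has probability above \<open>1 / sqrt n\<close>. For odd \<open>n\<close> the largest
  coefficient is half of the central coefficient of \<open>n + 1\<close>.
\<close>

lemma binomial_le_two_power_over_sqrt: "real (n choose k) * sqrt n \<le> 2 ^ n"
proof -
  have "real (n choose (n div 2)) * sqrt n \<le> 2 ^ n"
  proof (cases "even n")
    case True
    then obtain m where n: "n = 2 * m" by (elim evenE)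
    have "real (n choose m) * sqrt n \<le> real (2 * m choose m) * sqrt (2 * m + 1)"
      by (intro mult_mono) (auto simp: n)
    also have "\<dots> \<le> 2 ^ n"
      using central_binomial_upper_bound[of m] by (simp add: n power_mult)
    finally show ?thesis by (simp add: n)
  next
    case False
    then obtain m where n: "n = 2 * m + 1" by (elim oddE)
    have "2 * Suc m choose Suc m = 2 * (n choose m)"
      using binomial_symmetric[of m n] by (simp add: n)
    then have "2 * (real (n choose m) * sqrt n) \<le> real (2 * Suc m choose Suc m) * sqrt (2 * Suc m + 1)"
      by (simp add: n mult.assoc mult_left_mono)
    also have "\<dots> \<le> 2 * 2 ^ n"
      using central_binomial_upper_bound[of "Suc m"] by (simp add: n power_mult)
    finally show ?thesis by (simp add: n)
  qed
  then show ?thesis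
    using binomial_maximum[of n k]
    by (meson mult_right_mono of_nat_le_iff order_trans real_sqrt_ge_zero of_nat_0_le_iff)
qed

text \<open>
  The Bernstein polynomials are the binomial probabilities: \<open>Bernstein n k p\<close> is the probability of
  \<open>k\<close> successes in \<open>n\<close> independent trials of success probability \<open>p\<close>.
\<close>

lemma Bernstein_half: "Bernstein n k (1/2) = real (n choose k) / 2 ^ n" if "k \<le> n"
proof -
  have "(1/2 :: real) ^ k * (1/2) ^ (n - k) = (1/2) ^ n"
    using that by (simp only: power_add[symmetric]) simp
  then show ?thesis by (simp add: Bernstein_def power_one_over mult.assoc)
qed

lemma Bernstein_half_le: "Bernstein n k (1/2) \<le> 1 / sqrt n" if "0 < n" "k \<le> n"
  using binomial_le_two_power_over_sqrt[of n k] that by (simp add: Bernstein_half field_simps)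

lemma Bernstein_half_variance: "(\<Sum>k\<le>n. (2 * real k - n)\<^sup>2 * Bernstein n k (1/2)) = n"
proof -
  have "(\<Sum>k\<le>n. (2 * real k - n)\<^sup>2 * Bernstein n k (1/2)) =
      4 * (\<Sum>k\<le>n. real k * (real k - 1) * Bernstein n k (1/2)) +
      (4 - 4 * real n) * (\<Sum>k\<le>n. real k * Bernstein n k (1/2)) + n\<^sup>2 * (\<Sum>k\<le>n. Bernstein n k (1/2))"
    unfolding sum_distrib_left sum.distrib[symmetric]
    by (intro sum.cong refl) (simp add: power2_eq_square algebra_simps)
  also have "\<dots> = n"
    by (simp only: sum_k_Bernstein sum_kk_Bernstein sum_Bernstein)
       (simp add: power2_eq_square algebra_simps)
  finally show ?thesis .
qed

lemma card_diameter_le: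
  fixes K :: "nat set" and r :: real
  assumes "finite K" "0 \<le> r" and diam: "\<And>j k. j \<in> K \<Longrightarrow> k \<in> K \<Longrightarrow> real k - real j \<le> r"
  shows "real (card K) \<le> r + 1"
proof (cases "K = {}")
  case False
  have "card K \<le> card {Min K..Max K}"
    using assms False by (intro card_mono) auto
  moreover have "Min K \<le> Max K" using assms False by simp
  moreover have "real (Max K) - real (Min K) \<le> r" using assms False by simp
  ultimately show ?thesis by simp
qed (use assms in simp)

lemma sum_Un_le:
  fixes f :: "'a \<Rightarrow> real"
  assumes "finite A" "finite B" "\<And>x. 0 \<le> f x"
  shows "sum f (A \<union> B) \<le> sum f A + sum f B"
  using assms by (simp add: sum_Un sum_nonneg)

text \<open>
  The signed sum \<open>s = 2k - n\<close> of \<open>n\<close> fair signs lies between \<open>sqrt n / 4\<close> and \<open>2 sqrt n\<close> with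
  probability bounded below. Chebyshev's inequality gives at most \<open>1/4\<close> to \<open>\<bar>s\<bar> > 2 sqrt n\<close>; the
  interval \<open>\<bar>s\<bar> < sqrt n / 4\<close> contains at most \<open>sqrt n / 4 + 1\<close> values of \<open>k\<close>, each of probability at
  most \<open>1 / sqrt n\<close>, and so gets at most \<open>1/2\<close>. What remains is split evenly between the two
  signs by symmetry.
\<close>

lemma Bernstein_half_moderate_deviation:
  fixes n :: nat
  assumes n: "16 \<le> n"
  shows "1/8 \<le> (\<Sum>k | k \<le> n \<and> sqrt n / 4 \<le> 2 * real k - n \<and> 2 * real k - n \<le> 2 * sqrt n.
                    Bernstein n k (1/2))"
proof -
  let ?b = "\<lambda>k. Bernstein n k (1/2)"
  define far where "far = {k. k \<le> n \<and> 2 * sqrt n < \<bar>2 * real k - n\<bar>}"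
  define near where "near = {k. k \<le> n \<and> \<bar>2 * real k - n\<bar> < sqrt n / 4}"
  define right where "right = {k. k \<le> n \<and> sqrt n / 4 \<le> 2 * real k - n \<and> 2 * real k - n \<le> 2 * sqrt n}"
  define left where "left = {k. k \<le> n \<and> sqrt n / 4 \<le> n - 2 * real k \<and> n - 2 * real k \<le> 2 * sqrt n}"
  have fin: "finite far" "finite near" "finite right" "finite left"
    unfolding far_def near_def right_def left_def by auto
  have b0: "0 \<le> ?b k" for k by (rule Bernstein_nonneg) auto
  have "4 * n * sum ?b far = (\<Sum>k\<in>far. (2 * sqrt n)\<^sup>2 * ?b k)"
    by (simp add: sum_distrib_left power_mult_distrib)
  also have "\<dots> \<le> (\<Sum>k\<in>far. (2 * real k - n)\<^sup>2 * ?b k)"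
  proof (intro sum_mono mult_right_mono b0)
    fix k assume "k \<in> far"
    then have "\<bar>2 * sqrt n\<bar> \<le> \<bar>2 * real k - n\<bar>" by (simp add: far_def)
    then show "(2 * sqrt n)\<^sup>2 \<le> (2 * real k - n)\<^sup>2" by (rule abs_le_square_iff[THEN iffD1])
  qed
  also have "\<dots> \<le> (\<Sum>k\<le>n. (2 * real k - n)\<^sup>2 * ?b k)"
    by (intro sum_mono2) (auto simp: far_def b0)
  also have "\<dots> = n" by (rule Bernstein_half_variance)
  finally have far: "sum ?b far \<le> 1/4" using n by (simp add: field_simps)
  have s4: "4 \<le> sqrt n" using n real_le_rsqrt[of 4 n] by simp
  have card_near: "real (card near) \<le> sqrt n / 4 + 1"
  proof (intro card_diameter_le fin)
    fix j k assume "j \<in> near" "k \<in> near"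
    then show "real k - real j \<le> sqrt n / 4" unfolding near_def mem_Collect_eq by linarith
  qed simp
  have "sum ?b near \<le> real (card near) * (1 / sqrt n)"
    using n by (intro sum_bounded_above Bernstein_half_le) (auto simp: near_def)
  also have "\<dots> \<le> (sqrt n / 4 + 1) * (1 / sqrt n)"
    by (intro mult_right_mono card_near) auto
  also have "\<dots> = 1/4 + 1 / sqrt n" using n by (simp add: field_simps)
  also have "\<dots> \<le> 1/4 + 1/4" using s4 n by (intro add_left_mono divide_left_mono) auto
  finally have near: "sum ?b near \<le> 1/2" by simp
  have sym: "sum ?b left = sum ?b right"
    by (rule sum.reindex_bij_witness[of _ "\<lambda>k. n - k" "\<lambda>k. n - k"])
       (auto simp: left_def right_def of_nat_diff Bernstein_half binomial_symmetric[symmetric])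
  have "1 = (\<Sum>k\<le>n. ?b k)" by (simp only: sum_Bernstein)
  also have "{..n} = far \<union> (near \<union> (left \<union> right))"
    by (auto simp: far_def near_def left_def right_def abs_if split: if_splits)
  also have "sum ?b \<dots> \<le> sum ?b far + (sum ?b near + (sum ?b left + sum ?b right))"
    by (intro order_trans[OF sum_Un_le] add_mono order_refl fin finite_UnI b0)
  finally show ?thesis using far near sym by (simp add: right_def)
qed

text \<open>
  Lowering the success probability by \<open>d / 2\<close> changes the probability of \<open>k = i + s\<close> successes, where
  \<open>n = 2i + s\<close>, by the factor \<open>(1 - d\<^sup>2)^i (1 - d)^s\<close>. For \<open>d\<close> of order \<open>1 / sqrt n\<close> and \<open>s\<close> of order
  \<open>sqrt n\<close> both powers stay bounded below, by Bernoulli's inequality. This transfers the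
  anti-concentration of fair signs to slightly biased ones.
\<close>

lemma Bernstein_ge_half:
  fixes p d :: real
  assumes p: "p = (1 - d) / 2" and d: "0 \<le> d" "d \<le> 1" and k: "k \<le> n" "n \<le> 2 * k"
    and small: "n * d\<^sup>2 \<le> 1/2" "(2 * real k - n) * d \<le> 1/2"
  shows "Bernstein n k (1/2) / 4 \<le> Bernstein n k p"
proof -
  define i s where "i = n - k" and "s = 2 * k - n"
  have ki: "k = i + s" "n - k = i" "n = i + i + s" using k by (auto simp: i_def s_def)
  have "p ^ k * (1 - p) ^ (n - k) = (p * (1 - p)) ^ i * p ^ s"
    by (simp only: ki(2)) (simp add: ki(1) power_add power_mult_distrib)
  also have "p * (1 - p) = (1/2 * (1/2)) * (1 - d\<^sup>2)"
    by (simp add: p power2_eq_square field_simps)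
  also have "(1/2 * (1/2) * (1 - d\<^sup>2)) ^ i * p ^ s =
      (1/2) ^ n * ((1 - d\<^sup>2) ^ i * (1 - d) ^ s)"
    by (simp only: p ki(3) power_add power_mult_distrib power_divide) (simp add: field_simps)
  finally have eq: "p ^ k * (1 - p) ^ (n - k) = (1/2) ^ n * ((1 - d\<^sup>2) ^ i * (1 - d) ^ s)" .
  have "1/2 \<le> 1 - i * d\<^sup>2"
  proof -
    have "i * d\<^sup>2 \<le> n * d\<^sup>2" by (intro mult_right_mono) (auto simp: i_def)
    then show ?thesis using small by simp
  qed
  also have "\<dots> \<le> (1 - d\<^sup>2) ^ i"
    using Bernoulli_inequality[of "- d\<^sup>2" i] d power_le_one[of d 2] by simp
  finally have 1: "1/2 \<le> (1 - d\<^sup>2) ^ i" .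
  have "1/2 \<le> 1 - s * d" using small k by (simp add: s_def of_nat_diff)
  also have "\<dots> \<le> (1 - d) ^ s" using Bernoulli_inequality[of "- d" s] d by simp
  finally have 2: "1/2 \<le> (1 - d) ^ s" .
  have "(1/2 * (1/2) :: real) \<le> (1 - d\<^sup>2) ^ i * (1 - d) ^ s"
    using 1 2 by (intro mult_mono) auto
  then have "(1/2) ^ n / 4 \<le> p ^ k * (1 - p) ^ (n - k)"
    by (simp add: eq divide_simps)
  from mult_left_mono[OF this, of "real (n choose k)"] show ?thesis
    using k by (simp only: Bernstein_half) (simp add: Bernstein_def power_one_over mult.assoc)
qed

text \<open>
  The opposite comparison, valid for every bias. The exponential loss is harmless later, where it is
  multiplied by \<open>exp (- \<bar>2k - n\<bar> / T)\<close> with a small \<open>T\<close>.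
\<close>

lemma Bernstein_le_half:
  fixes p :: real
  assumes p: "0 \<le> p" "p \<le> 1" and k: "k \<le> n"
  shows "Bernstein n k p \<le> Bernstein n k (1/2) * exp \<bar>2 * real k - n\<bar>"
proof -
  \<comment> \<open>Pairing successes with failures leaves a power of \<open>p * (1 - p) \<le> 1/4\<close> and \<open>\<bar>2k - n\<bar>\<close> unpaired factors.\<close>
  have quarter: "p * (1 - p) \<le> 1/4"
    using sum_squares_bound[of p "1 - p"] zero_le_power2[of "2 * p - 1"]
    by (simp add: power2_eq_square algebra_simps)
  have e: "(1::real) ^ s \<le> (exp 1 / 2) ^ s" for s
    using exp_ge_add_one_self[of 1] by (intro power_mono) auto
  have *: "(p * (1 - p)) ^ i * q ^ s \<le> (1/2) ^ (i + i + s) * exp s" if "0 \<le> q" "q \<le> 1" for i s q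
  proof -
    have "(p * (1 - p)) ^ i * q ^ s \<le> (1/4) ^ i * (exp 1 / 2) ^ s"
    proof (rule mult_mono)
      show "(p * (1 - p)) ^ i \<le> (1/4) ^ i" using p quarter by (intro power_mono) auto
      show "q ^ s \<le> (exp 1 / 2) ^ s" using e[of s] power_mono[of q 1 s] that by simp
    qed (use that in auto)
    also have "\<dots> = (1/2) ^ (i + i + s) * exp s"
    proof -
      have "((1/2) ^ i * (1/2) ^ i :: real) = (1/4) ^ i" by (simp flip: power_mult_distrib)
      moreover have "exp (real s) = exp 1 ^ s" using exp_of_nat_mult[of s "1::real"] by simp
      ultimately show ?thesis by (simp add: power_add power_divide)
    qed
    finally show ?thesis .
  qed
  have "p ^ k * (1 - p) ^ (n - k) \<le> (1/2) ^ n * exp \<bar>2 * real k - n\<bar>"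
  proof (cases "n \<le> 2 * k")
    case True
    define i s where "i = n - k" and "s = 2 * k - n"
    have ki: "k = i + s" "n - k = i" "n = i + i + s" "\<bar>2 * real k - n\<bar> = s"
      using k True by (auto simp: i_def s_def of_nat_diff)
    have "p ^ k * (1 - p) ^ (n - k) = (p * (1 - p)) ^ i * p ^ s"
      by (simp only: ki(2)) (simp add: ki(1) power_add power_mult_distrib)
    then show ?thesis using *[of p i s] p by (simp only: ki(4)) (simp add: ki(3))
  next
    case False
    define s where "s = n - 2 * k"
    have ki: "n - k = k + s" "n = k + k + s" "\<bar>2 * real k - n\<bar> = s"
      using k False by (auto simp: s_def of_nat_diff)
    have "p ^ k * (1 - p) ^ (n - k) = (p * (1 - p)) ^ k * (1 - p) ^ s"
      by (simp only: ki(1)) (simp add: power_add power_mult_distrib)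
    then show ?thesis using *[of "1 - p" k s] p by (simp only: ki(3)) (simp add: ki(2))
  qed
  from mult_left_mono[OF this, of "real (n choose k)"] show ?thesis
    using k by (simp only: Bernstein_half) (simp add: Bernstein_def power_one_over mult.assoc)
qed

text \<open>
  Oddness of \<open>n\<close> keeps \<open>2k - n\<close> away from zero: it takes odd values only, so the sum carries the
  factor \<open>q\<close>. For even \<open>n\<close> the central term alone would contribute \<open>1\<close>.
\<close>

lemma sum_odd_geometric_le:
  fixes q :: real and n :: nat
  assumes "odd n" "0 \<le> q" "q < 1"
  shows "(\<Sum>k\<le>n. q ^ nat \<bar>2 * int k - int n\<bar>) \<le> 2 * q / (1 - q)"
proof -
  obtain m where n: "n = 2 * m + 1" using \<open>odd n\<close> by (elim oddE)
  have geo: "(\<Sum>j\<le>m. q ^ (2 * j + 1)) \<le> q / (1 - q)"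
  proof -
    have "(\<Sum>j\<le>m. q ^ (2 * j + 1)) \<le> (\<Sum>j\<le>m. q * q ^ j)"
      using assms by (intro sum_mono) (auto intro!: mult_left_mono power_decreasing)
    also have "\<dots> = q * ((1 - q ^ Suc m) / (1 - q))"
      using assms sum_gp0[of q m] by (simp add: sum_distrib_left[symmetric])
    also have "\<dots> \<le> q * (1 / (1 - q))"
      using assms by (intro mult_left_mono divide_right_mono) auto
    finally show ?thesis by simp
  qed
  have "{..n} = {..m} \<union> {m+1..n}" by (auto simp: n)
  then have "(\<Sum>k\<le>n. q ^ nat \<bar>2 * int k - int n\<bar>) =
      (\<Sum>k\<le>m. q ^ nat \<bar>2 * int k - int n\<bar>) + (\<Sum>k=m+1..n. q ^ nat \<bar>2 * int k - int n\<bar>)"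
    by (simp only:) (intro sum.union_disjoint, auto)
  also have "(\<Sum>k\<le>m. q ^ nat \<bar>2 * int k - int n\<bar>) = (\<Sum>j\<le>m. q ^ (2 * j + 1))"
  proof (rule sum.reindex_bij_witness[of _ "\<lambda>j. m - j" "\<lambda>j. m - j"])
    fix k assume "k \<in> {..m}"
    then have "nat \<bar>2 * int k - int n\<bar> = 2 * (m - k) + 1" by (auto simp: n)
    then show "q ^ (2 * (m - k) + 1) = q ^ nat \<bar>2 * int k - int n\<bar>" by simp
  qed auto
  also have "(\<Sum>k=m+1..n. q ^ nat \<bar>2 * int k - int n\<bar>) = (\<Sum>j\<le>m. q ^ (2 * j + 1))"
  proof (rule sum.reindex_bij_witness[of _ "\<lambda>j. m + 1 + j" "\<lambda>k. k - (m + 1)"])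
    fix k assume "k \<in> {m+1..n}"
    then have "nat \<bar>2 * int k - int n\<bar> = 2 * (k - (m + 1)) + 1" by (auto simp: n)
    then show "q ^ (2 * (k - (m + 1)) + 1) = q ^ nat \<bar>2 * int k - int n\<bar>" by simp
  qed (auto simp: n)
  finally show ?thesis using geo by simp
qed

section \<open>Independence: conditional expectations, counts and product spaces\<close>

lemma subalgebra_vimage_algebra:
  assumes W: "W \<in> measurable M S"
  shows "subalgebra M (vimage_algebra (space M) W S)"
  by (auto simp: subalgebra_def sets_vimage_algebra2 measurable_space[OF W] measurable_sets[OF W])

text \<open>
  Conditioning on \<open>W\<close> freezes the factor \<open>\<phi> (W \<omega>)\<close> and averages the independent factor out. By
  independence, both sides have the same integral over every event \<open>W \<in> A'\<close>; these events form the
  \<open>\<sigma>\<close>-algebra generated by \<open>W\<close>.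
\<close>

lemma (in prob_space) real_cond_exp_product_indep:
  fixes \<phi> \<psi> :: "_ \<Rightarrow> real"
  assumes indep: "indep_var S W T V"
    and \<phi>[measurable]: "\<phi> \<in> borel_measurable S" and \<psi>[measurable]: "\<psi> \<in> borel_measurable T"
    and int: "integrable M (\<lambda>\<omega>. \<phi> (W \<omega>))" "integrable M (\<lambda>\<omega>. \<psi> (V \<omega>))"
  shows "AE \<omega> in M. real_cond_exp M (vimage_algebra (space M) W S) (\<lambda>\<omega>. \<phi> (W \<omega>) * \<psi> (V \<omega>)) \<omega>
           = \<phi> (W \<omega>) * expectation (\<lambda>\<omega>. \<psi> (V \<omega>))"
proof -
  let ?D = "vimage_algebra (space M) W S"
  have W[measurable]: "W \<in> measurable M S" and V[measurable]: "V \<in> measurable M T"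
    using indep by (auto dest: indep_var_rv1 indep_var_rv2)
  have sub: "subalgebra M ?D"
    by (rule subalgebra_vimage_algebra[OF W])
  interpret D: finite_measure_subalgebra M ?D
    by unfold_locales (rule sub)
  have prod: "expectation (\<lambda>\<omega>. g (W \<omega>) * \<psi> (V \<omega>)) =
      expectation (\<lambda>\<omega>. g (W \<omega>)) * expectation (\<lambda>\<omega>. \<psi> (V \<omega>))"
    and prod_int: "integrable M (\<lambda>\<omega>. g (W \<omega>) * \<psi> (V \<omega>))"
    if [measurable]: "g \<in> borel_measurable S" and "integrable M (\<lambda>\<omega>. g (W \<omega>))" for g :: "_ \<Rightarrow> real"
  proof -
    have "indep_var borel (g \<circ> W) borel (\<psi> \<circ> V)"
      by (rule indep_var_compose[OF indep]) measurable
    then have "indep_var borel (\<lambda>\<omega>. g (W \<omega>)) borel (\<lambda>\<omega>. \<psi> (V \<omega>))" by (simp add: comp_def)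
    from indep_var_lebesgue_integral[OF this that(2) int(2)] indep_var_integrable[OF this that(2) int(2)]
    show "expectation (\<lambda>\<omega>. g (W \<omega>) * \<psi> (V \<omega>)) =
        expectation (\<lambda>\<omega>. g (W \<omega>)) * expectation (\<lambda>\<omega>. \<psi> (V \<omega>))"
      "integrable M (\<lambda>\<omega>. g (W \<omega>) * \<psi> (V \<omega>))" .
  qed
  show ?thesis
  proof (rule D.real_cond_exp_charact)
    fix A assume "A \<in> sets ?D"
    then obtain A' where A'[measurable]: "A' \<in> sets S" and A: "A = W -` A' \<inter> space M"
      by (auto simp: sets_vimage_algebra2 measurable_space[OF W])
    have ind: "indicator A \<omega> = (indicator A' (W \<omega>) :: real)" if "\<omega> \<in> space M" for \<omega>
      using that by (auto simp: A indicator_def)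
    define g where "g w = indicator A' w * \<phi> w" for w
    have [measurable]: "g \<in> borel_measurable S" unfolding g_def by measurable
    have gint: "integrable M (\<lambda>\<omega>. g (W \<omega>))"
    proof -
      have "integrable M (\<lambda>\<omega>. indicator (W -` A' \<inter> space M) \<omega> *\<^sub>R \<phi> (W \<omega>))"
        by (rule integrable_mult_indicator[OF _ int(1)]) measurable
      also have "?this \<longleftrightarrow> ?thesis"
        by (intro Bochner_Integration.integrable_cong) (auto simp: g_def indicator_def)
      finally show ?thesis .
    qed
    have "(\<integral>\<omega>\<in>A. \<phi> (W \<omega>) * \<psi> (V \<omega>) \<partial>M) = expectation (\<lambda>\<omega>. g (W \<omega>) * \<psi> (V \<omega>))"
      unfolding set_lebesgue_integral_def g_def
      by (intro Bochner_Integration.integral_cong) (auto simp: ind)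
    also have "\<dots> = expectation (\<lambda>\<omega>. g (W \<omega>) * expectation (\<lambda>\<omega>. \<psi> (V \<omega>)))"
      using prod[OF _ gint] by simp
    also have "\<dots> = (\<integral>\<omega>\<in>A. \<phi> (W \<omega>) * expectation (\<lambda>\<omega>. \<psi> (V \<omega>)) \<partial>M)"
      unfolding set_lebesgue_integral_def g_def
      by (intro Bochner_Integration.integral_cong) (auto simp: ind)
    finally show "(\<integral>\<omega>\<in>A. \<phi> (W \<omega>) * \<psi> (V \<omega>) \<partial>M) = \<dots>" .
  next
    show "integrable M (\<lambda>\<omega>. \<phi> (W \<omega>) * \<psi> (V \<omega>))" by (rule prod_int[OF \<phi> int(1)])
    show "integrable M (\<lambda>\<omega>. \<phi> (W \<omega>) * expectation (\<lambda>\<omega>. \<psi> (V \<omega>)))" using int(1) by simp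
    have "W \<in> measurable ?D S"
      by (rule measurable_vimage_algebra1) (auto simp: measurable_space[OF W])
    then show "(\<lambda>\<omega>. \<phi> (W \<omega>) * expectation (\<lambda>\<omega>. \<psi> (V \<omega>))) \<in> borel_measurable ?D" by measurable
  qed
qed

text \<open>
  The event is the disjoint union, over the sets \<open>J\<close> of \<open>k\<close> indices, of the events that exactly the
  trials in \<open>J\<close> succeed; independence turns the probability of each into a product.
\<close>

lemma (in prob_space) prob_card_successes:
  assumes indep: "indep_vars (\<lambda>_. S) V I" and I: "finite I" "I \<noteq> {}" and A[measurable]: "A \<in> sets S"
    and p: "\<And>i. i \<in> I \<Longrightarrow> prob (V i -` A \<inter> space M) = p"
  shows "prob {\<omega> \<in> space M. card {i \<in> I. V i \<omega> \<in> A} = k} = Bernstein (card I) k p"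
proof -
  have V[measurable]: "i \<in> I \<Longrightarrow> V i \<in> measurable M S" for i
    using indep by (auto simp: indep_vars_def)
  define E where "E J = {\<omega> \<in> space M. {i \<in> I. V i \<omega> \<in> A} = J}" for J
  define Js where "Js = {J. J \<subseteq> I \<and> card J = k}"
  have E: "E J = (\<Inter>i\<in>I. V i -` (if i \<in> J then A else space S - A) \<inter> space M)" if "J \<subseteq> I" for J
  proof -
    have "{i \<in> I. V i \<omega> \<in> A} = J \<longleftrightarrow> (\<forall>i\<in>I. V i \<omega> \<in> (if i \<in> J then A else space S - A))"
      if "\<omega> \<in> space M" for \<omega>
      using \<open>J \<subseteq> I\<close> measurable_space[OF V that] by (fastforce split: if_splits)
    then show ?thesis using I by (auto simp: E_def simp del: vimage_Diff)
  qed
  have Eprob: "prob (E J) = p ^ card J * (1 - p) ^ (card I - card J)" if J: "J \<subseteq> I" for J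
  proof -
    have compl: "prob (V i -` (space S - A) \<inter> space M) = 1 - p" if "i \<in> I" for i
    proof -
      have "V i -` (space S - A) \<inter> space M = space M - (V i -` A \<inter> space M)"
        using measurable_space[OF V[OF that]] by auto
      then show ?thesis using prob_compl[of "V i -` A \<inter> space M"] p that by simp
    qed
    have "prob (E J) = (\<Prod>i\<in>I. prob (V i -` (if i \<in> J then A else space S - A) \<inter> space M))"
      unfolding E[OF J] using I by (intro indep_varsD_finite[OF indep]) auto
    also have "\<dots> = (\<Prod>i\<in>I. if i \<in> J then p else 1 - p)"
      using p compl by (intro prod.cong) auto
    also have "\<dots> = p ^ card J * (1 - p) ^ card (I - J)"
      using I J by (simp add: prod.If_cases Int_absorb1 Diff_eq)
    finally show ?thesis using J I by (simp add: card_Diff_subset finite_subset)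
  qed
  have Emeas: "E J \<in> events" if "J \<subseteq> I" for J
    unfolding E[OF that] using I by (intro sets.finite_INT) (auto intro!: measurable_sets[OF V])
  have fin: "finite Js" unfolding Js_def using I by simp
  have "{\<omega> \<in> space M. card {i \<in> I. V i \<omega> \<in> A} = k} = (\<Union>J\<in>Js. E J)"
    by (auto simp: E_def Js_def)
  also have "prob \<dots> = (\<Sum>J\<in>Js. prob (E J))"
  proof (intro finite_measure_finite_Union fin)
    show "E ` Js \<subseteq> events" by (auto simp: Js_def Emeas)
    show "disjoint_family_on E Js" by (auto simp: disjoint_family_on_def E_def)
  qed
  also have "\<dots> = (\<Sum>J\<in>Js. p ^ k * (1 - p) ^ (card I - k))"
    by (intro sum.cong) (auto simp: Eprob Js_def)
  also have "\<dots> = Bernstein (card I) k p"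
    using I n_subsets[of I k] by (simp add: Bernstein_def Js_def)
  finally show ?thesis .
qed

lemma (in prob_space) expectation_finite_range:
  fixes h :: "nat \<Rightarrow> real"
  assumes [measurable]: "B \<in> measurable M (count_space UNIV)" and le: "\<And>\<omega>. \<omega> \<in> space M \<Longrightarrow> B \<omega> \<le> n"
  shows "expectation (\<lambda>\<omega>. h (B \<omega>)) = (\<Sum>k\<le>n. h k * prob {\<omega> \<in> space M. B \<omega> = k})"
proof -
  have "expectation (\<lambda>\<omega>. h (B \<omega>)) =
      expectation (\<lambda>\<omega>. \<Sum>k\<le>n. h k * indicator {\<omega> \<in> space M. B \<omega> = k} \<omega>)"
    using le by (intro Bochner_Integration.integral_cong) 
       (auto simp: indicator_def if_distrib[of "(*) _"] sum.delta' cong: if_cong)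
  also have "\<dots> = (\<Sum>k\<le>n. h k * prob ({\<omega> \<in> space M. B \<omega> = k} \<inter> space M))"
    by (subst Bochner_Integration.integral_sum)
       (auto intro!: integrable_mult_right sum.cong simp: emeasure_eq_measure)
  finally show ?thesis by (simp add: Int_absorb2 Collect_restrict)
qed

text \<open>
  Any measurable transformation \<open>g\<close> of the coordinates of a finite product of copies of \<open>\<mu>\<close> yields
  i.i.d. copies. Coordinate \<open>0\<close> is the generic observation, coordinates \<open>1, \<dots>, n\<close> are the data.
\<close>

lemma iid_copies_exist:
  fixes n :: nat and \<mu> :: "'z measure" and g :: "'z \<Rightarrow> 'y"
  assumes \<mu>: "prob_space \<mu>" and g: "g \<in> measurable \<mu> S"
  defines "M \<equiv> PiM {0..n} (\<lambda>_. \<mu>)"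
  shows "iid_copies M S n (\<lambda>\<omega>. g (\<omega> 0)) (\<lambda>i \<omega>. g (\<omega> i))"
    and "\<And>i. i \<in> {0..n} \<Longrightarrow> distr M \<mu> (\<lambda>\<omega>. \<omega> i) = \<mu>"
proof -
  interpret \<mu>: prob_space \<mu> by fact
  interpret P: product_prob_space "\<lambda>_. \<mu>" "{0..n}" ..
  interpret M: prob_space M unfolding M_def by (rule P.prob_space_axioms)
  have coord: "(\<lambda>\<omega>. \<omega> i) \<in> measurable M \<mu>" if "i \<in> {0..n}" for i
    using that unfolding M_def by (rule measurable_component_singleton)
  show distr: "distr M \<mu> (\<lambda>\<omega>. \<omega> i) = \<mu>" if "i \<in> {0..n}" for i
    using P.PiM_component[OF that] by (simp add: M_def)
  have "M.indep_vars (\<lambda>_. \<mu>) (\<lambda>i \<omega>. \<omega> i) {0..n}"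
  proof (subst M.indep_vars_iff_distr_eq_PiM')
    have "distr M (PiM {0..n} (\<lambda>_. \<mu>)) (\<lambda>\<omega>. \<lambda>i\<in>{0..n}. \<omega> i) = distr M M (\<lambda>\<omega>. \<omega>)"
    proof (rule distr_cong)
      fix \<omega> assume "\<omega> \<in> space M"
      then show "(\<lambda>i\<in>{0..n}. \<omega> i) = \<omega>" unfolding M_def space_PiM by (rule PiE_restrict)
    qed (simp_all only: M_def)
    also have "\<dots> = M" by (rule distr_id)
    also have "M = PiM {0..n} (\<lambda>i. distr M \<mu> (\<lambda>\<omega>. \<omega> i))"
      by (subst (1) M_def, rule PiM_cong) (simp_all only: distr)
    finally show "distr M (PiM {0..n} (\<lambda>_. \<mu>)) (\<lambda>\<omega>. \<lambda>i\<in>{0..n}. \<omega> i) =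
        PiM {0..n} (\<lambda>i. distr M \<mu> (\<lambda>\<omega>. \<omega> i))" .
  qed (auto intro: coord)
  then have "M.indep_vars (\<lambda>_. S) (\<lambda>i \<omega>. g (\<omega> i)) {0..n}"
    by (rule M.indep_vars_compose2) (rule g)
  moreover have "(\<lambda>i \<omega>. g (\<omega> i))(0 := \<lambda>\<omega>. g (\<omega> 0)) = (\<lambda>(i::nat) \<omega>. g (\<omega> i))"
    by (simp add: fun_eq_iff)
  moreover have "distr M S (\<lambda>\<omega>. g (\<omega> i)) = distr \<mu> S g" if "i \<in> {0..n}" for i
    using distr_distr[OF g coord[OF that]] distr[OF that] by (simp add: comp_def)
  ultimately show "iid_copies M S n (\<lambda>\<omega>. g (\<omega> 0)) (\<lambda>i \<omega>. g (\<omega> i))"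
    by (simp add: iid_copies_def)
qed

section \<open>Exponential weights for two complementary indicators\<close>

text \<open>
  The weight of the first of two functions whose losses always add up to \<open>1\<close>, when the first one has
  total empirical loss \<open>x\<close> on \<open>n\<close> observations. The argument is real so that the weight can be
  composed with a real-valued sum over the data.
\<close>

definition first_weight :: "nat \<Rightarrow> real \<Rightarrow> real \<Rightarrow> real" where
  "first_weight n T x = 1 / (1 + exp ((2 * x - real n) / T))"

lemma first_weight_bounds: "0 < first_weight n T x" "first_weight n T x < 1"
  by (simp_all add: first_weight_def add_pos_pos)

lemma first_weight_le_exp: "first_weight n T x \<le> exp (- ((2 * x - real n) / T))"
  by (simp add: first_weight_def exp_minus divide_simps add_pos_pos)

lemma first_weight_le_half: "first_weight n T x \<le> 1/2" if "real n \<le> 2 * x" "0 < T"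
  using that by (simp add: first_weight_def divide_simps add_pos_pos)

text \<open>
  Unless the data are balanced up to the order of the temperature, one of the two weights is
  exponentially small. This limits the benefit that the aggregate draws from mixing.
\<close>

lemma first_weight_variance_le:
  "first_weight n T x * (1 - first_weight n T x) \<le> exp (- (\<bar>2 * x - real n\<bar> / T))"
  if "0 < T"
proof (cases "real n \<le> 2 * x")
  case True
  have "first_weight n T x * (1 - first_weight n T x) \<le> first_weight n T x * 1"
    using first_weight_bounds[of n T x] by (intro mult_left_mono) auto
  also have "\<dots> \<le> exp (- (\<bar>2 * x - real n\<bar> / T))"
    using first_weight_le_exp[of n T x] True by simp
  finally show ?thesis .
next
  case False
  have "1 - first_weight n T x = exp ((2 * x - real n) / T) / (1 + exp ((2 * x - real n) / T))"
    by (simp add: first_weight_def field_simps add_pos_pos add_nonneg_eq_0_iff)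
  also have "\<dots> \<le> exp ((2 * x - real n) / T) / 1"
    by (intro divide_left_mono) (auto simp: add_pos_pos)
  also have "\<dots> = exp (- (\<bar>2 * x - real n\<bar> / T))" using False by (simp add: minus_divide_left)
  finally have *: "1 - first_weight n T x \<le> exp (- (\<bar>2 * x - real n\<bar> / T))" .
  have "first_weight n T x * (1 - first_weight n T x) \<le> 1 * (1 - first_weight n T x)"
    using first_weight_bounds[of n T x] by (intro mult_right_mono) auto
  with * show ?thesis by simp
qed

lemma sum_pair: "f \<noteq> g \<Longrightarrow> (\<Sum>h\<in>{f, g}. q h) = q f + q g"
  by simp

text \<open>
  For \<open>Y = 0\<close>, the total empirical loss of the first indicator is the number of observations with
  \<open>X = 1\<close>, and that of the second is the number of the others.
\<close>

lemma aew_indicators: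
  fixes d :: "nat \<Rightarrow> real \<times> real" and T :: real
  assumes n: "0 < n" and Y0: "\<And>i. i \<in> {1..n} \<Longrightarrow> snd (d i) = 0"
  defines "\<theta> \<equiv> first_weight n T (card {i \<in> {1..n}. fst (d i) = 1})"
  shows "aew n T d {indicator {1}, indicator (-{1})} x = (if x = 1 then \<theta> else 1 - \<theta>)"
proof -
  let ?f = "indicator {1} :: real \<Rightarrow> real" and ?g = "indicator (-{1}) :: real \<Rightarrow> real"
  define k where "k = card {i \<in> {1..n}. fst (d i) = 1}"
  have fg: "?f \<noteq> ?g" by (auto simp: fun_eq_iff indicator_def intro: exI[of _ 1])
  have "(\<Sum>i=1..n. quad_loss (d i) ?f) = (\<Sum>i\<in>{1..n}. of_bool (fst (d i) = 1))"
    using Y0 by (intro sum.cong) (auto simp: quad_loss_def indicator_def)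
  also have "\<dots> = real k" by (simp add: k_def Int_def)
  finally have Sf: "(\<Sum>i=1..n. quad_loss (d i) ?f) = real k" .
  have "(\<Sum>i=1..n. quad_loss (d i) ?g) = (\<Sum>i\<in>{1..n}. 1 - of_bool (fst (d i) = 1))"
    using Y0 by (intro sum.cong) (auto simp: quad_loss_def indicator_def)
  also have "\<dots> = real n - real k" by (simp add: sum_subtractf k_def Int_def)
  finally have Sg: "(\<Sum>i=1..n. quad_loss (d i) ?g) = real n - real k" .
  \<comment> \<open>The sample size cancels: the exponents only see the total loss.\<close>
  have scale: "(real n / T) * (a / real n) = a / T" for a using n by simp
  have ef: "- (real n / T) * emp_risk n d ?f = - real k / T"
    unfolding emp_risk_def Sf using scale[of "real k"] by simp
  have eg: "- (real n / T) * emp_risk n d ?g = (real k - real n) / T"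
  proof -
    have "- (real n / T) * emp_risk n d ?g = - ((real n - real k) / T)"
      unfolding emp_risk_def Sg using scale[of "real n - real k"] by (simp only: mult_minus_left)
    then show ?thesis by (simp only: minus_divide_left minus_diff_eq)
  qed
  define a b where "a = exp (- real k / T)" and "b = exp ((real k - real n) / T)"
  have pos: "0 < a" "0 < b" by (simp_all add: a_def b_def)
  have "(\<Sum>h\<in>{?f, ?g}. exp (- (real n / T) * emp_risk n d h)) = a + b"
    by (simp only: sum_pair[OF fg] ef eg a_def b_def)
  then have w: "aew_weight n T d {?f, ?g} ?f = a / (a + b)" "aew_weight n T d {?f, ?g} ?g = b / (a + b)"
    by (simp_all only: aew_weight_def ef eg a_def b_def)
  have "b = a * exp ((2 * real k - n) / T)"
  proof -
    have "(real k - real n) / T = - real k / T + (2 * real k - n) / T"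
      by (simp only: add_divide_distrib[symmetric]) simp
    then show ?thesis by (simp only: a_def b_def exp_add)
  qed
  then have "a / (a + b) = a / (a * (1 + exp ((2 * real k - n) / T)))" by (simp only: distrib_left mult_1_right)
  also have "\<dots> = \<theta>"
    using pos by (simp add: \<theta>_def first_weight_def k_def)
  finally have wf: "a / (a + b) = \<theta>" .
  have "a / (a + b) + b / (a + b) = 1" using pos by (simp add: add_divide_distrib[symmetric])
  then have wg: "b / (a + b) = 1 - \<theta>" using wf by simp
  have "aew n T d {?f, ?g} x = a / (a + b) * ?f x + b / (a + b) * ?g x"
    by (simp only: aew_def sum_pair[OF fg] w)
  then show ?thesis by (simp add: wf wg)
qed

section \<open>Excess risk as a function of the sample\<close>

text \<open>
  If the first function has risk \<open>p\<close>, the second \<open>1 - p\<close> and \<open>\<Delta> = 1 - 2p\<close>, the aggregate with weights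
  \<open>\<theta>\<close> and \<open>1 - \<theta>\<close> has risk \<open>p \<theta>\<^sup>2 + (1 - p) (1 - \<theta>)\<^sup>2 = p + (1 - \<theta>) (\<Delta> - \<theta>)\<close>. The following is the
  second summand, as a function of the total empirical loss \<open>k\<close> of the first function.
\<close>

definition excess :: "nat \<Rightarrow> real \<Rightarrow> real \<Rightarrow> nat \<Rightarrow> real" where
  "excess n T \<Delta> k = (1 - first_weight n T k) * (\<Delta> - first_weight n T k)"

text \<open>
  The samples on which the worse function looks better, by a margin of the order of the standard
  deviation. The upper bound keeps them in the range where biased and fair signs are comparable.
\<close>

definition wrong_majority :: "nat \<Rightarrow> nat set" where
  "wrong_majority n = {k. k \<le> n \<and> sqrt n / 4 \<le> 2 * real k - n \<and> 2 * real k - n \<le> 2 * sqrt n}"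

lemma wrong_majority_probability:
  fixes n :: nat
  assumes n: "64 \<le> n" and p: "p = (1 - 1 / (4 * sqrt n)) / 2"
  shows "1/32 \<le> (\<Sum>k\<in>wrong_majority n. Bernstein n k p)"
proof -
  have s: "8 \<le> sqrt n" using n real_le_rsqrt[of 8 n] by simp
  have "1/32 \<le> (\<Sum>k\<in>wrong_majority n. Bernstein n k (1/2) / 4)"
    using Bernstein_half_moderate_deviation[of n] n
    by (simp add: wrong_majority_def sum_divide_distrib[symmetric])
  also have "\<dots> \<le> (\<Sum>k\<in>wrong_majority n. Bernstein n k p)"
  proof (intro sum_mono Bernstein_ge_half[OF p])
    fix k assume k: "k \<in> wrong_majority n"
    then show "k \<le> n" by (simp add: wrong_majority_def)
    from k s have "real n \<le> real (2 * k)" unfolding wrong_majority_def by simp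
    then show "n \<le> 2 * k" by (simp only: of_nat_le_iff)
    have "(2 * real k - n) * (1 / (4 * sqrt n)) \<le> (2 * sqrt n) * (1 / (4 * sqrt n))"
      using k by (intro mult_right_mono) (auto simp: wrong_majority_def)
    also have "\<dots> = 1/2" using n by simp
    finally show "(2 * real k - n) * (1 / (4 * sqrt n)) \<le> 1/2" .
  qed (use s in \<open>auto simp: power_mult_distrib power_divide divide_le_eq\<close>)
  finally show ?thesis .
qed

text \<open>
  The temperature bound makes the exponent of the weight at least \<open>ln n\<close> in absolute value. Hence the
  weight \<open>\<theta>\<close> of the better function is at most \<open>1 / n\<close>, well below \<open>\<Delta> = 1 / (4 sqrt n)\<close>, and the excess
  is essentially \<open>\<Delta>\<close>.
\<close>

lemma excess_ge_of_wrong_majority: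
  fixes n :: nat
  assumes n: "64 \<le> n" and T: "0 < T" "T \<le> 1/4 * sqrt n / ln n" and k: "k \<in> wrong_majority n"
  shows "1/16 / sqrt n \<le> excess n T (1 / (4 * sqrt n)) k"
proof -
  let ?th = "first_weight n T k"
  have s: "8 \<le> sqrt n" using n real_le_rsqrt[of 8 n] by simp
  have ln: "0 < ln n" using n by simp
  have k': "sqrt n / 4 \<le> 2 * real k - n" using k by (simp add: wrong_majority_def)
  have "T * ln n \<le> sqrt n / 4" using T(2) ln by (simp add: field_simps)
  also note k'
  finally have "ln n \<le> (2 * real k - n) / T" using T(1) by (simp add: field_simps)
  then have "?th \<le> exp (- ln n)" by (intro order_trans[OF first_weight_le_exp]) simp
  also have "\<dots> = 1 / (sqrt n * sqrt n)" using n by (simp add: exp_minus inverse_eq_divide)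
  also have "\<dots> \<le> 1 / (8 * sqrt n)"
    using s n by (intro divide_left_mono mult_right_mono) auto
  finally have th: "?th \<le> 1 / (8 * sqrt n)" .
  have half: "?th \<le> 1/2" using k' s T by (intro first_weight_le_half) auto
  have "1/16 / sqrt n = (1/2) * (1 / (8 * sqrt n))" by simp
  also have "\<dots> \<le> (1 - ?th) * (1 / (4 * sqrt n) - ?th)"
    using th half s by (intro mult_mono) (auto simp: field_simps)
  finally show ?thesis by (simp add: excess_def)
qed

text \<open>
  The excess is \<open>\<Delta> (1 - \<theta>) - \<theta> (1 - \<theta>)\<close>. A wrong majority makes the expectation of the first term at
  least \<open>1 / (256 sqrt n)\<close>. The second term, the benefit of mixing, is at most \<open>exp (-16 \<bar>s\<bar>)\<close> for
  \<open>s = 2k - n\<close>. It only matters when \<open>\<bar>s\<bar>\<close> is bounded, which also has probability of order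
  \<open>1 / sqrt n\<close>; so the two terms have the same order. But \<open>s\<close> is odd, so that \<open>\<bar>s\<bar> \<ge> 1\<close>, and the low
  temperature makes the second one at most half of the first.
\<close>

lemma expected_excess_ge:
  fixes n :: nat
  assumes n: "64 \<le> n" "odd n" and T: "0 < T" "T \<le> 1/16" and p: "p = (1 - 1 / (4 * sqrt n)) / 2"
  shows "1/512 / sqrt n \<le> (\<Sum>k\<le>n. excess n T (1 / (4 * sqrt n)) k * Bernstein n k p)"
proof -
  let ?d = "1 / (4 * sqrt n)" and ?s = "\<lambda>k. \<bar>2 * real k - n\<bar>"
  have s: "8 \<le> sqrt n" using n real_le_rsqrt[of 8 n] by simp
  have d01: "0 \<le> ?d" "?d \<le> 1" using s by (auto simp: divide_le_eq)
  have "0 \<le> (1 - d) / 2 \<and> (1 - d) / 2 \<le> 1" if "0 \<le> d" "d \<le> 1" for d :: real using that by auto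
  from this[OF d01] have p01: "0 \<le> p" "p \<le> 1" by (simp_all only: p)
  have b0: "0 \<le> Bernstein n k p" for k using p01 by (intro Bernstein_nonneg) auto
  have ex: "?d / 2 * indicator (wrong_majority n) k - exp (- 16 * ?s k) \<le> excess n T ?d k" for k
  proof -
    let ?th = "first_weight n T k"
    have "1/2 * indicator (wrong_majority n) k \<le> 1 - ?th"
    proof (cases "k \<in> wrong_majority n")
      case True
      then have "?th \<le> 1/2" using s T by (intro first_weight_le_half) (auto simp: wrong_majority_def)
      then show ?thesis using True by simp
    qed (use first_weight_bounds[of n T k] in simp)
    from mult_left_mono[OF this, of ?d]
    have "?d / 2 * indicator (wrong_majority n) k \<le> ?d * (1 - ?th)" using s by simp
    moreover have "?th * (1 - ?th) \<le> exp (- 16 * ?s k)"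
    proof -
      have "16 * ?s k \<le> ?s k / T"
        using T mult_right_mono[of "16 * T" 1 "?s k"] by (simp add: field_simps)
      then show ?thesis
        by (intro order_trans[OF first_weight_variance_le[OF T(1)]]) simp
    qed
    moreover have "excess n T ?d k = ?d * (1 - ?th) - ?th * (1 - ?th)"
      by (simp add: excess_def algebra_simps)
    ultimately show ?thesis by linarith
  qed
  \<comment> \<open>One unit of the exponent pays for replacing the biased signs by fair ones.\<close>
  have "(\<Sum>k\<le>n. exp (- 16 * ?s k) * Bernstein n k p) \<le>
      (\<Sum>k\<le>n. exp (-15) ^ nat \<bar>2 * int k - int n\<bar> * (1 / sqrt n))"
  proof (intro sum_mono)
    fix k assume "k \<in> {..n}"
    then have k: "k \<le> n" by simp
    have "exp (- 16 * ?s k) * Bernstein n k p \<le> exp (- 16 * ?s k) * (1 / sqrt n * exp (?s k))"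
      using n by (intro mult_left_mono order_trans[OF Bernstein_le_half[OF p01 k]] mult_right_mono
        Bernstein_half_le k) auto
    also have "\<dots> = exp (- 15 * ?s k) * (1 / sqrt n)"
      by (simp add: mult.assoc[symmetric] flip: exp_add)
    also have "exp (- 15 * ?s k) = exp (-15) ^ nat \<bar>2 * int k - int n\<bar>"
    proof -
      have "?s k = real (nat \<bar>2 * int k - int n\<bar>)" by simp
      then show ?thesis by (metis exp_of_nat_mult mult.commute)
    qed
    finally show "exp (- 16 * ?s k) * Bernstein n k p \<le> \<dots> * (1 / sqrt n)" .
  qed
  also have "\<dots> = (\<Sum>k\<le>n. exp (-15) ^ nat \<bar>2 * int k - int n\<bar>) * (1 / sqrt n)"
    by (rule sum_distrib_right[symmetric])
  also have "\<dots> \<le> (2 * exp (-15) / (1 - exp (-15))) * (1 / sqrt n)"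
    using n by (intro mult_right_mono sum_odd_geometric_le) auto
  also have "2 * exp (-15) / (1 - exp (-15)) \<le> (1/512 :: real)"
  proof -
    have "(2::real) ^ 15 \<le> exp 1 ^ 15" using exp_ge_add_one_self[of 1] by (intro power_mono) auto
    also have "\<dots> = exp 15" using exp_of_nat_mult[of 15 "1::real"] by simp
    finally have "exp (-15) \<le> (1 / 2 ^ 15 :: real)" by (simp add: exp_minus field_simps)
    then show ?thesis by (simp add: field_simps)
  qed
  finally have small: "(\<Sum>k\<le>n. exp (- 16 * ?s k) * Bernstein n k p) \<le> 1/512 / sqrt n"
    by (simp add: divide_right_mono)
  have "1/256 / sqrt n = ?d / 2 * (1/32)" by simp
  also have "\<dots> \<le> ?d / 2 * (\<Sum>k\<in>wrong_majority n. Bernstein n k p)"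
    using wrong_majority_probability[OF n(1) p] by (intro mult_left_mono) auto
  also have "\<dots> = (\<Sum>k\<le>n. ?d / 2 * indicator (wrong_majority n) k * Bernstein n k p)"
  proof -
    have "(\<Sum>k\<in>wrong_majority n. Bernstein n k p) = (\<Sum>k\<le>n. indicator (wrong_majority n) k * Bernstein n k p)"
      by (rule sum.mono_neutral_cong_left) (auto simp: wrong_majority_def indicator_def)
    then show ?thesis by (simp only: sum_distrib_left mult.assoc)
  qed
  finally have big: "1/256 / sqrt n \<le> (\<Sum>k\<le>n. ?d / 2 * indicator (wrong_majority n) k * Bernstein n k p)" .
  have "1/512 / sqrt n \<le> (\<Sum>k\<le>n. ?d / 2 * indicator (wrong_majority n) k * Bernstein n k p)
      - (\<Sum>k\<le>n. exp (- 16 * ?s k) * Bernstein n k p)"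
    using big small by linarith
  also have "\<dots> = (\<Sum>k\<le>n. (?d / 2 * indicator (wrong_majority n) k - exp (- 16 * ?s k)) * Bernstein n k p)"
    by (simp add: sum_subtractf left_diff_distrib)
  also have "\<dots> \<le> (\<Sum>k\<le>n. excess n T ?d k * Bernstein n k p)"
    by (intro sum_mono mult_right_mono ex b0)
  finally show ?thesis .
qed

section \<open>The risk of the aggregate\<close>

text \<open>
  Almost surely all observations have \<open>Y = 0\<close>, so the aggregate depends on the data through the number
  \<open>B\<close> of observations with \<open>X = 1\<close> only. Its loss at the fresh observation is
  \<open>\<theta>\<^sup>2\<close> if \<open>X = 1\<close> and \<open>(1 - \<theta>)\<^sup>2\<close> otherwise: a sum of two products of a function of the data and a
  function of the independent fresh observation, whose conditional expectations are explicit.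
\<close>

lemma (in prob_space) aew_risk_indicators:
  fixes X :: "'a \<Rightarrow> real" and Zs :: "nat \<Rightarrow> 'a \<Rightarrow> real \<times> real"
  assumes n: "0 < n" and X[measurable]: "X \<in> borel_measurable M"
    and p: "prob {\<omega> \<in> space M. X \<omega> = 1} = p"
    and iid: "iid_copies M (borel \<Otimes>\<^sub>M borel) n (\<lambda>\<omega>. (X \<omega>, 0)) Zs"
  defines "B \<equiv> \<lambda>\<omega>. card {i \<in> {1..n}. fst (Zs i \<omega>) = 1}"
  shows "AE \<omega> in M. aew_risk M borel n T (\<lambda>\<omega>. (X \<omega>, 0)) Zs {indicator {1}, indicator (-{1})} \<omega> =
           p + excess n T (1 - 2 * p) (B \<omega>)"
    and "prob {\<omega> \<in> space M. B \<omega> = k} = Bernstein n k p"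
    and "B \<in> measurable M (count_space UNIV)"
proof -
  let ?S = "borel \<Otimes>\<^sub>M borel :: (real \<times> real) measure"
  let ?Z = "\<lambda>\<omega>. (X \<omega>, 0 :: real)"
  let ?F = "{indicator {1}, indicator (-{1})} :: (real \<Rightarrow> real) set"
  let ?th = "\<lambda>x. first_weight n T x"
  have indep: "indep_vars (\<lambda>_. ?S) (Zs(0 := ?Z)) {0..n}"
    and same: "\<And>i. i \<in> {1..n} \<Longrightarrow> distr M ?S (Zs i) = distr M ?S ?Z"
    using iid by (auto simp: iid_copies_def)
  have Zs[measurable]: "Zs i \<in> measurable M ?S" if "i \<in> {1..n}" for i
  proof -
    have "(Zs(0 := ?Z)) i \<in> measurable M ?S"
      using indep that unfolding indep_vars_def by (auto simp del: fun_upd_apply)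
    then show ?thesis using that by simp
  qed
  have prob_Zs: "prob (Zs i -` A \<inter> space M) = prob (?Z -` A \<inter> space M)"
    if "A \<in> sets ?S" "i \<in> {1..n}" for A i
    using same[OF that(2)] that measure_distr[OF Zs[OF that(2)] that(1)] measure_distr[of ?Z M ?S A]
    by simp
  have "AE \<omega> in M. snd (Zs i \<omega>) = 0" if i: "i \<in> {1..n}" for i
  proof -
    have "AE z in distr M ?S ?Z. snd z = 0" by (subst AE_distr_iff) auto
    then have "AE z in distr M ?S (Zs i). snd z = 0" by (simp only: same[OF i])
    then show ?thesis using i by (subst (asm) AE_distr_iff) auto
  qed
  then have Y0: "AE \<omega> in M. \<forall>i\<in>{1..n}. snd (Zs i \<omega>) = 0" by (intro AE_finite_allI) auto

  \<comment> \<open>\<open>W\<close> is the data, \<open>V\<close> the fresh observation, kept as a family over the index \<open>0\<close> because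
    independence of disjoint subfamilies is stated for restrictions.\<close>
  define W where "W \<omega> = (\<lambda>i\<in>{1..n}. Zs i \<omega>)" for \<omega>
  define V where "V \<omega> = (\<lambda>i\<in>{0::nat}. ?Z \<omega>)" for \<omega>
  define m where "m w = (\<Sum>i\<in>{1..n}. indicator {1} (fst (w i)) :: real)" for w :: "nat \<Rightarrow> real \<times> real"
  define \<psi> where "\<psi> v = (indicator {1} (fst (v 0)) :: real)" for v :: "nat \<Rightarrow> real \<times> real"
  have mW: "m (W \<omega>) = real (B \<omega>)" for \<omega>
    by (simp add: m_def W_def B_def indicator_def Int_def)
  have \<psi>V: "\<psi> (V \<omega>) = indicator {1} (X \<omega>)" for \<omega> by (simp add: \<psi>_def V_def)
  have [measurable]: "m \<in> borel_measurable (PiM {1..n} (\<lambda>_. ?S))"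
    unfolding m_def by measurable
  have [measurable]: "\<psi> \<in> borel_measurable (PiM {0} (\<lambda>_. ?S))"
    unfolding \<psi>_def by measurable
  have [measurable]: "?th \<in> borel_measurable borel"
    unfolding first_weight_def by measurable
  have m1: "(\<lambda>w. (?th (m w))\<^sup>2) \<in> borel_measurable (PiM {1..n} (\<lambda>_. ?S))"
    and m2: "(\<lambda>w. (1 - ?th (m w))\<^sup>2) \<in> borel_measurable (PiM {1..n} (\<lambda>_. ?S))"
    and \<psi>1: "\<psi> \<in> borel_measurable (PiM {0} (\<lambda>_. ?S))"
    and \<psi>2: "(\<lambda>v. 1 - \<psi> v) \<in> borel_measurable (PiM {0} (\<lambda>_. ?S))"
    by measurable
  have WV: "indep_var (PiM {1..n} (\<lambda>_. ?S)) W (PiM {0} (\<lambda>_. ?S)) V"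
  proof -
    have "indep_var (PiM {1..n} (\<lambda>_. ?S)) (\<lambda>\<omega>. restrict (\<lambda>i. (Zs(0 := ?Z)) i \<omega>) {1..n})
        (PiM {0} (\<lambda>_. ?S)) (\<lambda>\<omega>. restrict (\<lambda>i. (Zs(0 := ?Z)) i \<omega>) {0})"
      by (rule indep_var_restrict[OF indep]) auto
    also have "(\<lambda>\<omega>. restrict (\<lambda>i. (Zs(0 := ?Z)) i \<omega>) {1..n}) = W"
      by (auto simp: W_def fun_eq_iff)
    also have "(\<lambda>\<omega>. restrict (\<lambda>i. (Zs(0 := ?Z)) i \<omega>) {0}) = V"
      by (auto simp: V_def fun_eq_iff)
    finally show ?thesis .
  qed
  have [measurable]: "W \<in> measurable M (PiM {1..n} (\<lambda>_. ?S))" "V \<in> measurable M (PiM {0} (\<lambda>_. ?S))"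
    using WV by (auto dest: indep_var_rv1 indep_var_rv2)

  let ?A = "{1} \<times> UNIV :: (real \<times> real) set"
  have A: "?A \<in> sets ?S" by (intro pair_measureI) auto
  have "B \<omega> = card {i \<in> {1..n}. Zs i \<omega> \<in> ?A}" for \<omega>
    by (simp add: B_def mem_Times_iff)
  moreover have "prob (Zs i -` ?A \<inter> space M) = p" if "i \<in> {1..n}" for i
    using prob_Zs[OF A that] p by (simp add: vimage_def Int_def conj_commute)
  moreover have "indep_vars (\<lambda>_. ?S) Zs {1..n}"
  proof -
    have "indep_vars (\<lambda>_. ?S) (Zs(0 := ?Z)) {1..n}"
      by (rule indep_vars_subset[OF indep]) auto
    then show ?thesis by (rule indep_vars_cong[THEN iffD1, rotated -1]) auto
  qed
  ultimately show "prob {\<omega> \<in> space M. B \<omega> = k} = Bernstein n k p"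
    using n A prob_card_successes[where S = ?S and V = Zs and I = "{1..n}" and A = ?A and p = p and k = k]
    by simp

  have "(\<lambda>\<omega>. real (B \<omega>)) \<in> borel_measurable M"
    unfolding mW[symmetric] by measurable
  then have "(\<lambda>\<omega>. nat \<lfloor>real (B \<omega>)\<rfloor>) \<in> measurable M (count_space UNIV)" by measurable
  then show Bm: "B \<in> measurable M (count_space UNIV)" by simp

  define D where "D = data_algebra M ?S n Zs"
  have D: "D = vimage_algebra (space M) W (PiM {1..n} (\<lambda>_. ?S))"
    by (simp add: D_def data_algebra_def W_def[abs_def])
  have sub: "subalgebra M D"
    unfolding D by (rule subalgebra_vimage_algebra) measurable
  interpret D: finite_measure_subalgebra M D by unfold_locales (rule sub)

  let ?g = "\<lambda>\<omega>. ?th (m (W \<omega>))"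
  have th01: "\<bar>?th x\<bar> \<le> 1" "\<bar>1 - ?th x\<bar> \<le> 1" for x
    using first_weight_bounds[of n T x] by auto
  define loss where "loss \<omega> = quad_loss (?Z \<omega>) (aew n T (\<lambda>i. Zs i \<omega>) ?F)" for \<omega>
  define l1 where "l1 \<omega> = (?g \<omega>)\<^sup>2 * \<psi> (V \<omega>)" for \<omega>
  define l2 where "l2 \<omega> = (1 - ?g \<omega>)\<^sup>2 * (1 - \<psi> (V \<omega>))" for \<omega>
  have int_g: "integrable M (\<lambda>\<omega>. (?g \<omega>)\<^sup>2)" "integrable M (\<lambda>\<omega>. (1 - ?g \<omega>)\<^sup>2)"
    by (auto intro!: integrable_const_bound[where B = 1] simp: power_le_one_iff abs_square_le_1 th01)
  have int_\<psi>: "integrable M (\<lambda>\<omega>. \<psi> (V \<omega>))" "integrable M (\<lambda>\<omega>. 1 - \<psi> (V \<omega>))"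
    by (auto intro!: integrable_const_bound[where B = 1] simp: \<psi>_def indicator_def)
  have E\<psi>: "expectation (\<lambda>\<omega>. \<psi> (V \<omega>)) = p"
  proof -
    have "expectation (\<lambda>\<omega>. \<psi> (V \<omega>)) = expectation (indicator {\<omega> \<in> space M. X \<omega> = 1})"
      by (intro Bochner_Integration.integral_cong) (auto simp: \<psi>V indicator_def)
    also have "\<dots> = p" using p by (simp add: Int_absorb2 Collect_restrict)
    finally show ?thesis .
  qed
  have [measurable]: "loss \<in> borel_measurable M"
  proof -
    have ne: "(indicator {1} :: real \<Rightarrow> real) \<noteq> indicator (-{1})"
      by (auto simp: fun_eq_iff indicator_def intro: exI[of _ 1])
    show ?thesis
      unfolding loss_def quad_loss_def aew_def aew_weight_def emp_risk_def
      using ne by simp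
  qed
  have "AE \<omega> in M. loss \<omega> = l1 \<omega> + l2 \<omega>"
    using Y0
  proof eventually_elim
    case (elim \<omega>)
    then show ?case
      using aew_indicators[OF n, of "\<lambda>i. Zs i \<omega>" T "X \<omega>"]
      by (simp add: loss_def quad_loss_def l1_def l2_def mW B_def \<psi>V)
  qed
  then have 1: "AE \<omega> in M. real_cond_exp M D loss \<omega> = real_cond_exp M D (\<lambda>\<omega>. l1 \<omega> + l2 \<omega>) \<omega>"
    by (rule D.real_cond_exp_cong) (auto simp: l1_def[abs_def] l2_def[abs_def])
  have l1: "AE \<omega> in M. real_cond_exp M D l1 \<omega> = (?g \<omega>)\<^sup>2 * p"
    using real_cond_exp_product_indep[where \<phi> = "\<lambda>w. (?th (m w))\<^sup>2" and \<psi> = \<psi>,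
        OF WV m1 \<psi>1 int_g(1) int_\<psi>(1), folded D]
    unfolding l1_def[abs_def] E\<psi> .
  have "expectation (\<lambda>\<omega>. 1 - \<psi> (V \<omega>)) = 1 - p"
    using int_\<psi> by (simp add: E\<psi> prob_space)
  then have l2: "AE \<omega> in M. real_cond_exp M D l2 \<omega> = (1 - ?g \<omega>)\<^sup>2 * (1 - p)"
    using real_cond_exp_product_indep[where \<phi> = "\<lambda>w. (1 - ?th (m w))\<^sup>2" and \<psi> = "\<lambda>v. 1 - \<psi> v",
        OF WV m2 \<psi>2 int_g(2) int_\<psi>(2), folded D]
    unfolding l2_def[abs_def] by (simp only:)
  have int_l: "integrable M l1" "integrable M l2"
    unfolding l1_def[abs_def] l2_def[abs_def]
    by (auto intro!: integrable_const_bound[where B = 1] simp: \<psi>_def indicator_def abs_square_le_1 th01)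
  have 2: "AE \<omega> in M. real_cond_exp M D (\<lambda>\<omega>. l1 \<omega> + l2 \<omega>) \<omega> =
      real_cond_exp M D l1 \<omega> + real_cond_exp M D l2 \<omega>"
    by (rule D.real_cond_exp_add[OF int_l])
  have risk: "aew_risk M borel n T ?Z Zs ?F = real_cond_exp M D loss"
    by (simp add: aew_risk_def cond_risk_def D_def loss_def[abs_def])
  show "AE \<omega> in M. aew_risk M borel n T ?Z Zs ?F \<omega> = p + excess n T (1 - 2 * p) (B \<omega>)"
    unfolding risk using 1 2 l1 l2
  proof eventually_elim
    case (elim \<omega>)
    show ?case unfolding elim mW excess_def by (simp add: power2_eq_square algebra_simps)
  qed
qed

theorem theoremA:
  "\<exists>c0 c1 c2 c3 c4 c5 :: real.
     0 < c0 \<and> 0 < c1 \<and> 0 < c2 \<and> 0 < c3 \<and> 0 < c4 \<and> 0 < c5 \<and>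
     (\<forall>n::nat. c0 \<le> real n \<longrightarrow>
       (\<exists>(M :: (nat \<Rightarrow> real \<times> real) measure) (N :: real measure)
          (X :: (nat \<Rightarrow> real \<times> real) \<Rightarrow> real) (Y :: (nat \<Rightarrow> real \<times> real) \<Rightarrow> real)
          (Z :: (nat \<Rightarrow> real \<times> real) \<Rightarrow> real \<times> real)
          (f1 :: real \<Rightarrow> real) (f2 :: real \<Rightarrow> real) (F :: (real \<Rightarrow> real) set).
          prob_space M \<and> X \<in> measurable M N \<and> Y \<in> borel_measurable M \<and>
          Z = (\<lambda>\<omega>. (X \<omega>, Y \<omega>)) \<and>
          F = {f1, f2} \<and> f1 \<noteq> f2 \<and>
          f1 \<in> borel_measurable N \<and> f2 \<in> borel_measurable N \<and>
          (AE \<omega> in M. (Y \<omega> - f1 (X \<omega>))\<^sup>2 \<le> 1) \<and>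
          (AE \<omega> in M. (Y \<omega> - f2 (X \<omega>))\<^sup>2 \<le> 1) \<and>
          (\<exists>Zs. iid_copies M (N \<Otimes>\<^sub>M borel) n Z Zs) \<and>
          (\<forall>Zs. iid_copies M (N \<Otimes>\<^sub>M borel) n Z Zs \<longrightarrow>
            (\<forall>T>0.
              (T \<le> c1 \<and> odd n \<longrightarrow>
                 (\<integral>\<omega>. aew_risk M N n T Z Zs F \<omega> \<partial>M)
                   \<ge> Min (quad_risk M Z ` F) + c2 / sqrt (real n)) \<and>
              (T \<le> c3 * sqrt (real n) / ln (real n) \<longrightarrow>
                 measure M {\<omega> \<in> space M. aew_risk M N n T Z Zs F \<omega>
                   \<ge> Min (quad_risk M Z ` F) + c5 / sqrt (real n)} > c4)))))"
proof (rule exI[of _ 64], rule exI[of _ "1/16"], rule exI[of _ "1/512"], rule exI[of _ "1/4"],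
    rule exI[of _ "1/64"], rule exI[of _ "1/16"], intro conjI allI impI)
  fix n :: nat
  assume "64 \<le> real n"
  then have n: "64 \<le> n" by simp
  have s: "8 \<le> sqrt n" using n real_le_rsqrt[of 8 n] by simp
  \<comment> \<open>The gap between the two risks: small enough for the sampling noise to hide it, and of the
    order of the claimed excess.\<close>
  define \<Delta> where "\<Delta> = 1 / (4 * sqrt n)"
  define p where "p = (1 - \<Delta>) / 2"
  have \<Delta>: "0 < \<Delta>" "\<Delta> \<le> 1" using s n by (auto simp: \<Delta>_def divide_le_eq)
  have "0 \<le> p" "p \<le> 1/2" "1 - 2 * p = \<Delta>" using \<Delta> by (auto simp: p_def field_simps)
  moreover have "p = (1 - 1 / (4 * sqrt n)) / 2" unfolding p_def \<Delta>_def ..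
  ultimately have p: "0 \<le> p" "p \<le> 1/2" "1 - 2 * p = \<Delta>" "p = (1 - 1 / (4 * sqrt n)) / 2" .
  let ?S = "borel \<Otimes>\<^sub>M borel :: (real \<times> real) measure"
  define \<mu> where "\<mu> = distr (measure_pmf (bernoulli_pmf p)) ?S (\<lambda>b. (of_bool b, 0))"
  define M where "M = PiM {0..n} (\<lambda>_. \<mu>)"
  define X where "X \<omega> = fst (\<omega> 0)" for \<omega> :: "nat \<Rightarrow> real \<times> real"
  let ?Z = "\<lambda>\<omega>. (X \<omega>, 0 :: real)"
  let ?f1 = "indicator {1} :: real \<Rightarrow> real" and ?f2 = "indicator (-{1}) :: real \<Rightarrow> real"
  have \<mu>: "prob_space \<mu>" unfolding \<mu>_def by (rule measure_pmf.prob_space_distr) (simp add: space_pair_measure)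
  have sets_\<mu>[measurable_cong]: "sets \<mu> = sets ?S" by (simp add: \<mu>_def)
  have M: "prob_space M" unfolding M_def by (intro prob_space_PiM \<mu>)
  interpret prob_space M by (rule M)
  have g: "(\<lambda>z. (fst z, 0)) \<in> measurable \<mu> ?S" by measurable
  have iid: "iid_copies M ?S n ?Z (\<lambda>i \<omega>. (fst (\<omega> i), 0))"
    using iid_copies_exist(1)[OF \<mu> g, of n] by (simp add: M_def X_def[abs_def])
  have coord: "(\<lambda>\<omega>. \<omega> 0) \<in> measurable M \<mu>"
    unfolding M_def by (rule measurable_component_singleton) simp
  have X[measurable]: "X \<in> borel_measurable M"
  proof -
    have "fst \<in> borel_measurable \<mu>" by measurable
    from measurable_compose[OF coord this] show ?thesis by (simp add: X_def[abs_def])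
  qed
  have pX: "prob {\<omega> \<in> space M. X \<omega> = 1} = p"
  proof -
    have A: "{1} \<times> UNIV \<in> sets \<mu>" unfolding sets_\<mu> by (intro pair_measureI) auto
    have "{\<omega> \<in> space M. X \<omega> = 1} = (\<lambda>\<omega>. \<omega> 0) -` ({1} \<times> UNIV) \<inter> space M"
      by (auto simp: X_def mem_Times_iff)
    also have "prob \<dots> = measure (distr M \<mu> (\<lambda>\<omega>. \<omega> 0)) ({1} \<times> UNIV)"
      by (rule measure_distr[OF coord A, symmetric])
    also have "distr M \<mu> (\<lambda>\<omega>. \<omega> 0) = \<mu>"
      using iid_copies_exist(2)[OF \<mu> g, of 0 n] by (simp add: M_def)
    also have "measure \<mu> ({1} \<times> UNIV) = measure (measure_pmf (bernoulli_pmf p)) {True}"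
      unfolding \<mu>_def using A unfolding sets_\<mu>
      by (subst measure_distr) (auto intro!: arg_cong[where f = "measure _"] simp: space_pair_measure split: if_splits)
    also have "\<dots> = p" using p(1,2) by (simp add: measure_pmf_single)
    finally show ?thesis .
  qed
  have R1: "quad_risk M ?Z ?f1 = p"
  proof -
    have "quad_risk M ?Z ?f1 = expectation (indicator {\<omega> \<in> space M. X \<omega> = 1})"
      unfolding quad_risk_def quad_loss_def
      by (intro Bochner_Integration.integral_cong) (auto simp: indicator_def)
    then show ?thesis using pX by (simp add: Int_absorb2 Collect_restrict)
  qed
  have R2: "quad_risk M ?Z ?f2 = 1 - p"
  proof -
    have "quad_risk M ?Z ?f2 = expectation (\<lambda>\<omega>. 1 - indicator {\<omega> \<in> space M. X \<omega> = 1} \<omega>)"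
      unfolding quad_risk_def quad_loss_def
      by (intro Bochner_Integration.integral_cong) (auto simp: indicator_def)
    also have "\<dots> = 1 - prob {\<omega> \<in> space M. X \<omega> = 1}"
      by (subst Bochner_Integration.integral_diff) (auto simp: emeasure_eq_measure prob_space Int_absorb2 Collect_restrict)
    finally show ?thesis using pX by simp
  qed
  have minR: "Min (quad_risk M ?Z ` {?f1, ?f2}) = p" using p(1,2) by (simp add: R1 R2)
  have lower: "(T \<le> 1/16 \<and> odd n \<longrightarrow>
        (\<integral>\<omega>. aew_risk M borel n T ?Z Zs {?f1, ?f2} \<omega> \<partial>M) \<ge> p + 1/512 / sqrt n) \<and>
      (T \<le> 1/4 * sqrt n / ln n \<longrightarrow>
        prob {\<omega> \<in> space M. aew_risk M borel n T ?Z Zs {?f1, ?f2} \<omega> \<ge> p + 1/16 / sqrt n} > 1/64)"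
    if Zs: "iid_copies M ?S n ?Z Zs" and T: "0 < T" for Zs T
  proof -
    let ?risk = "aew_risk M borel n T ?Z Zs {?f1, ?f2}"
    define B where "B \<omega> = card {i \<in> {1..n}. fst (Zs i \<omega>) = 1}" for \<omega>
    have "0 < n" using n by simp
    note fam = aew_risk_indicators[OF \<open>0 < n\<close> X pX Zs, folded B_def]
    have risk: "AE \<omega> in M. ?risk \<omega> = p + excess n T \<Delta> (B \<omega>)" using fam(1) by (simp only: p(3))
    have [measurable]: "B \<in> measurable M (count_space UNIV)" by (rule fam(3))
    have Bn: "B \<omega> \<le> n" for \<omega>
    proof -
      have "B \<omega> \<le> card {1..n}" unfolding B_def by (rule card_mono) auto
      then show ?thesis by simp
    qed
    have exp_B: "expectation (\<lambda>\<omega>. h (B \<omega>)) = (\<Sum>k\<le>n. h k * Bernstein n k p)" for h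
      using expectation_finite_range[of B n h] Bn fam(2) by simp
    have [measurable]: "?risk \<in> borel_measurable M" by (simp add: aew_risk_def cond_risk_def)
    have "(\<integral>\<omega>. ?risk \<omega> \<partial>M) \<ge> p + 1/512 / sqrt n" if "T \<le> 1/16" "odd n"
    proof -
      have "integrable M (\<lambda>\<omega>. excess n T \<Delta> (B \<omega>))"
      proof (rule integrable_const_bound)
        show "AE \<omega> in M. norm (excess n T \<Delta> (B \<omega>)) \<le> (\<Sum>k\<le>n. \<bar>excess n T \<Delta> k\<bar>)"
          using Bn by (auto intro!: member_le_sum[of _ "{..n}" "\<lambda>k. \<bar>excess n T \<Delta> k\<bar>"])
      qed measurable
      then have split: "expectation (\<lambda>\<omega>. p + excess n T \<Delta> (B \<omega>)) =
          p + expectation (\<lambda>\<omega>. excess n T \<Delta> (B \<omega>))"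
        by (simp add: prob_space)
      have "p + 1/512 / sqrt n \<le> p + expectation (\<lambda>\<omega>. excess n T \<Delta> (B \<omega>))"
        using expected_excess_ge[OF n \<open>odd n\<close> T \<open>T \<le> 1/16\<close> p(4)]
        by (simp only: exp_B \<Delta>_def add_le_cancel_left)
      also have "\<dots> = (\<integral>\<omega>. ?risk \<omega> \<partial>M)"
        unfolding split[symmetric]
      proof (rule integral_cong_AE)
        show "AE \<omega> in M. p + excess n T \<Delta> (B \<omega>) = ?risk \<omega>"
          using risk by eventually_elim simp
      qed measurable
      finally show ?thesis .
    qed
    moreover have "prob {\<omega> \<in> space M. ?risk \<omega> \<ge> p + 1/16 / sqrt n} > 1/64"
      if "T \<le> 1/4 * sqrt n / ln n"
    proof -
      have "(1/64::real) < 1/32" by simp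
      also have "\<dots> \<le> (\<Sum>k\<in>wrong_majority n. Bernstein n k p)"
        by (rule wrong_majority_probability[OF n p(4)])
      also have "\<dots> = (\<Sum>k\<le>n. indicator (wrong_majority n) k * Bernstein n k p)"
        by (rule sum.mono_neutral_cong_left) (auto simp: wrong_majority_def indicator_def)
      also have "\<dots> = expectation (indicator {\<omega> \<in> space M. B \<omega> \<in> wrong_majority n})"
        unfolding exp_B[symmetric] by (intro Bochner_Integration.integral_cong) (auto simp: indicator_def)
      also have "\<dots> = prob {\<omega> \<in> space M. B \<omega> \<in> wrong_majority n}"
        by (simp add: Int_absorb2 Collect_restrict)
      also have "\<dots> \<le> prob {\<omega> \<in> space M. ?risk \<omega> \<ge> p + 1/16 / sqrt n}"
      proof (rule finite_measure_mono_AE)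
        show "AE \<omega> in M. \<omega> \<in> {\<omega> \<in> space M. B \<omega> \<in> wrong_majority n} \<longrightarrow>
            \<omega> \<in> {\<omega> \<in> space M. ?risk \<omega> \<ge> p + 1/16 / sqrt n}"
          using risk
        proof eventually_elim
          case (elim \<omega>)
          then show ?case
            using excess_ge_of_wrong_majority[OF n T that, of "B \<omega>"] by (auto simp: \<Delta>_def)
        qed
      qed measurable
      finally show ?thesis .
    qed
    ultimately show ?thesis by blast
  qed
  have loss: "AE \<omega> in M. (0 - ?f1 (X \<omega>))\<^sup>2 \<le> 1" "AE \<omega> in M. (0 - ?f2 (X \<omega>))\<^sup>2 \<le> 1"
    by (auto simp: indicator_def)
  have ne: "?f1 \<noteq> ?f2" by (auto simp: fun_eq_iff indicator_def intro: exI[of _ 1])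
  show "\<exists>(M :: (nat \<Rightarrow> real \<times> real) measure) (N :: real measure)
          (X :: (nat \<Rightarrow> real \<times> real) \<Rightarrow> real) (Y :: (nat \<Rightarrow> real \<times> real) \<Rightarrow> real)
          (Z :: (nat \<Rightarrow> real \<times> real) \<Rightarrow> real \<times> real)
          (f1 :: real \<Rightarrow> real) (f2 :: real \<Rightarrow> real) (F :: (real \<Rightarrow> real) set).
          prob_space M \<and> X \<in> measurable M N \<and> Y \<in> borel_measurable M \<and>
          Z = (\<lambda>\<omega>. (X \<omega>, Y \<omega>)) \<and>
          F = {f1, f2} \<and> f1 \<noteq> f2 \<and>
          f1 \<in> borel_measurable N \<and> f2 \<in> borel_measurable N \<and>
          (AE \<omega> in M. (Y \<omega> - f1 (X \<omega>))\<^sup>2 \<le> 1) \<and>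
          (AE \<omega> in M. (Y \<omega> - f2 (X \<omega>))\<^sup>2 \<le> 1) \<and>
          (\<exists>Zs. iid_copies M (N \<Otimes>\<^sub>M borel) n Z Zs) \<and>
          (\<forall>Zs. iid_copies M (N \<Otimes>\<^sub>M borel) n Z Zs \<longrightarrow>
            (\<forall>T>0.
              (T \<le> 1/16 \<and> odd n \<longrightarrow>
                 (\<integral>\<omega>. aew_risk M N n T Z Zs F \<omega> \<partial>M)
                   \<ge> Min (quad_risk M Z ` F) + 1/512 / sqrt (real n)) \<and>
              (T \<le> 1/4 * sqrt (real n) / ln (real n) \<longrightarrow>
                 measure M {\<omega> \<in> space M. aew_risk M N n T Z Zs F \<omega>
                   \<ge> Min (quad_risk M Z ` F) + 1/16 / sqrt (real n)} > 1/64)))"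
    by (rule exI[of _ M], rule exI[of _ borel], rule exI[of _ X], rule exI[of _ "\<lambda>_. 0"],
        rule exI[of _ ?Z], rule exI[of _ ?f1], rule exI[of _ ?f2], rule exI[of _ "{?f1, ?f2}"])
       (use M X ne loss iid lower minR in \<open>auto simp del: Min_insert\<close>)
qed (simp_all)

end
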